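(* (Dynkin case.) Let $\Gamma$ be a simply-laced Dynkin graph with vertex set $I$ and positive roots $\Delta_+\subset\mathbb{Z}^I$. A configuration $v\in\mathbb{R}^I$ is winning (for the numbers game with a cutoff) if and only if $$\alpha\cdot v\ge -1\quad\text{for all }\alpha\in\Delta_+ .$$ Otherwise, $v$ is losing. (Extended Dynkin case.) Let $\widetilde\Gamma$ be a simply-laced extended Dynkin graph with vertex set $\widetilde I$ and positive real roots $\widetilde\Delta_+\subset\mathbb{Z}^{\widetilde I}$, and let $v\in\mathbb{R}^{\widetilde I}$ with $v\neq0$. Consider the condition $$(\ast)\qquad \alpha\cdot v\ge -1\quad\text{for all }\alpha\in\widetilde\Delta_+ .$$ Then: - $v$ is winning if and only if both $(\ast)$ holds and $\delta\cdot v\neq0$; - if $(\ast)$ holds but $\delta\cdot v=0$, then $v$ is looping and the game cannot terminate; - if $(\ast)$ does not hold (e.g., if $\delta\cdot v<0$), then $v$ is losing.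
   Context: Simply-laced Dynkin graphs are those of type $A_n$ ($n\ge1$), $D_n$ ($n\ge4$), $E_6,E_7,E_8$; simply-laced extended Dynkin graphs are those of type $\widetilde A_n$ ($n\ge2$, a cycle), $\widetilde D_n$ ($n\ge4$), $\widetilde E_6,\widetilde E_7,\widetilde E_8$ (no loops or multiple edges). For such a graph with vertex set $I$, the Cartan form on $\mathbb{R}^I$ (with basis the simple roots $\alpha_i$, the elementary vectors) is $\langle\alpha_i,\alpha_i\rangle=2$, $\langle\alpha_i,\alpha_j\rangle=-1$ if $i,j$ are adjacent, and $0$ otherwise. The set of positive (real) roots is $\{\alpha\in\mathbb{Z}_{\ge0}^I:\langle\alpha,\alpha\rangle=2\}$, denoted $\Delta_+$ in the Dynkin case and $\widetilde\Delta_+$ in the extended Dynkin case. In the extended Dynkin case, $\delta\in\mathbb{Z}_{>0}^{\widetilde I}$ is the primitive vector with positive integer coordinates spanning the kernel of the Cartan form. The symbol $\cdot$ is the standard dot product on $\mathbb{R}^I$. Numbers game with a cutoff: configurations are vectors $v\in\mathbb{R}^I$, whose entries $v_i$ are called amplitudes. If $v_i<0$ one may fire the vertex $i$, replacing $v$ by $f_i(v)$, where $f_i(v)_i=-v_i$, $f_i(v)_j=v_j+v_i$ if $j$ is adjacent to $i$, and $f_i(v)_j=v_j$ otherwise. A configuration is allowed if all amplitudes are $\ge-1$, and forbidden otherwise. Moves are made only from allowed configurations: the game ends upon reaching (or starting at) a forbidden configuration, and it also ends when all amplitudes are nonnegative. A configuration is winning if it is possible, playing the game with a cutoff from it, to reach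 a configuration with all amplitudes nonnegative. It is losing if, no matter how the game is played, one reaches a forbidden configuration. It is looping if, however the game is played, it continues indefinitely (never reaching a forbidden configuration or one with all amplitudes nonnegative) and only finitely many configurations are reached. *)

theory Defs
  imports "HOL-Analysis.Analysis"
begin

text \<open>
  A graph is given by an adjacency relation on a finite type \<open>'n\<close>, which plays the role of the
  vertex set \<open>I\<close>.  The model graphs below live on \<open>{..<m}\<close> and list every edge in one direction only.
\<close>

definition path_edges :: "nat \<Rightarrow> (nat \<times> nat) set" where
  "path_edges m = {(k, Suc k) | k. Suc k < m}"

definition graph_iso_to :: "('n \<Rightarrow> 'n \<Rightarrow> bool) \<Rightarrow> nat \<Rightarrow> (nat \<times> nat) set \<Rightarrow> bool" where
  "graph_iso_to adj m R \<longleftrightarrow>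
     (\<exists>\<phi>. bij_betw \<phi> UNIV {..<m} \<and>
          (\<forall>i j. adj i j \<longleftrightarrow> (\<phi> i, \<phi> j) \<in> R \<or> (\<phi> j, \<phi> i) \<in> R))"

text \<open>
  \<open>D\<^sub>n\<close> is a path on \<open>n - 1\<close> vertices with a leaf attached next to one end; \<open>E\<^sub>n\<close> is a path on
  \<open>n - 1\<close> vertices with a leaf attached at its third vertex.
\<close>

definition dynkin_graph :: "('n \<Rightarrow> 'n \<Rightarrow> bool) \<Rightarrow> bool" where
  "dynkin_graph adj \<longleftrightarrow>
     (\<exists>n\<ge>1. graph_iso_to adj n (path_edges n)) \<or>
     (\<exists>n\<ge>4. graph_iso_to adj n (path_edges (n - 1) \<union> {(n - 3, n - 1)})) \<or>
     (\<exists>n\<in>{6, 7, 8}. graph_iso_to adj n (path_edges (n - 1) \<union> {(2, n - 1)}))"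

text \<open>
  In order: a cycle on \<open>n + 1\<close> vertices (\<open>A\<^sub>n\<close> extended); a path on \<open>n - 1\<close> vertices with a leaf
  attached next to each end (\<open>D\<^sub>n\<close> extended); and the stars whose three arms have \<open>2, 2, 2\<close>,
  \<open>3, 3, 1\<close> and \<open>2, 5, 1\<close> edges (\<open>E\<^sub>6\<close>, \<open>E\<^sub>7\<close>, \<open>E\<^sub>8\<close> extended).
\<close>

definition extended_dynkin_graph :: "('n \<Rightarrow> 'n \<Rightarrow> bool) \<Rightarrow> bool" where
  "extended_dynkin_graph adj \<longleftrightarrow>
     (\<exists>n\<ge>2. graph_iso_to adj (n + 1) (path_edges (n + 1) \<union> {(n, 0)})) \<or>
     (\<exists>n\<ge>4. graph_iso_to adj (n + 1) (path_edges (n - 1) \<union> {(1, n - 1), (n - 3, n)})) \<or>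
     graph_iso_to adj 7 (path_edges 5 \<union> {(2, 5), (5, 6)}) \<or>
     graph_iso_to adj 8 (path_edges 7 \<union> {(3, 7)}) \<or>
     graph_iso_to adj 9 (path_edges 8 \<union> {(2, 8)})"

definition cartan_entry :: "('n \<Rightarrow> 'n \<Rightarrow> bool) \<Rightarrow> 'n \<Rightarrow> 'n \<Rightarrow> real" where
  "cartan_entry adj i j = (if i = j then 2 else if adj i j then -1 else 0)"

definition cartan_form :: "('n::finite \<Rightarrow> 'n \<Rightarrow> bool) \<Rightarrow> real^'n \<Rightarrow> real^'n \<Rightarrow> real" where
  "cartan_form adj x y = (\<Sum>i\<in>UNIV. \<Sum>j\<in>UNIV. x $ i * cartan_entry adj i j * y $ j)"

definition positive_roots :: "('n::finite \<Rightarrow> 'n \<Rightarrow> bool) \<Rightarrow> (real^'n) set" where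
  "positive_roots adj = {\<alpha>. (\<forall>i. \<alpha> $ i \<in> \<nat>) \<and> cartan_form adj \<alpha> \<alpha> = 2}"

definition is_delta :: "('n::finite \<Rightarrow> 'n \<Rightarrow> bool) \<Rightarrow> real^'n \<Rightarrow> bool" where
  "is_delta adj d \<longleftrightarrow>
     (\<exists>m :: 'n \<Rightarrow> nat. (\<forall>i. 0 < m i \<and> d $ i = real (m i)) \<and> Gcd (range m) = 1) \<and>
     {x. \<forall>y. cartan_form adj x y = 0} = span {d}"

text \<open>Meaningful for extended Dynkin graphs, where exactly one vector satisfies \<open>is_delta\<close>.\<close>

definition delta :: "('n::finite \<Rightarrow> 'n \<Rightarrow> bool) \<Rightarrow> real^'n" where
  "delta adj = (THE d. is_delta adj d)"

definition fire :: "('n::finite \<Rightarrow> 'n \<Rightarrow> bool) \<Rightarrow> 'n \<Rightarrow> real^'n \<Rightarrow> real^'n" where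
  "fire adj i v =
     (\<chi> j. if j = i then - v $ i else if adj i j then v $ j + v $ i else v $ j)"

definition forbidden :: "real^'n \<Rightarrow> bool" where
  "forbidden v \<longleftrightarrow> (\<exists>i. v $ i < -1)"

definition nonneg :: "real^'n \<Rightarrow> bool" where
  "nonneg v \<longleftrightarrow> (\<forall>i. 0 \<le> v $ i)"

definition game_over :: "real^'n \<Rightarrow> bool" where
  "game_over v \<longleftrightarrow> forbidden v \<or> nonneg v"

text \<open>
  A complete play from \<open>v\<close>, as an infinite sequence of configurations: as long as the game is not
  over a vertex of negative amplitude must be fired; once it is over the final configuration is
  repeated.
\<close>

definition play :: "('n::finite \<Rightarrow> 'n \<Rightarrow> bool) \<Rightarrow> real^'n \<Rightarrow> (nat \<Rightarrow> real^'n) \<Rightarrow> bool" where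
  "play adj v p \<longleftrightarrow> p 0 = v \<and>
     (\<forall>k. if game_over (p k) then p (Suc k) = p k
          else \<exists>i. p k $ i < 0 \<and> p (Suc k) = fire adj i (p k))"

definition winning :: "('n::finite \<Rightarrow> 'n \<Rightarrow> bool) \<Rightarrow> real^'n \<Rightarrow> bool" where
  "winning adj v \<longleftrightarrow> (\<exists>p k. play adj v p \<and> nonneg (p k))"

definition losing :: "('n::finite \<Rightarrow> 'n \<Rightarrow> bool) \<Rightarrow> real^'n \<Rightarrow> bool" where
  "losing adj v \<longleftrightarrow> (\<forall>p. play adj v p \<longrightarrow> (\<exists>k. forbidden (p k)))"

definition cannot_terminate :: "('n::finite \<Rightarrow> 'n \<Rightarrow> bool) \<Rightarrow> real^'n \<Rightarrow> bool" where
  "cannot_terminate adj v \<longleftrightarrow> (\<forall>p. play adj v p \<longrightarrow> (\<forall>k. \<not> game_over (p k)))"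

text \<open>
  Finiteness is required of the set of configurations reached in all plays together.
\<close>

definition looping :: "('n::finite \<Rightarrow> 'n \<Rightarrow> bool) \<Rightarrow> real^'n \<Rightarrow> bool" where
  "looping adj v \<longleftrightarrow> cannot_terminate adj v \<and> finite {p k | p k. play adj v p}"

end

theory Submission
  imports Defs
begin

text \<open>
  Firing \<open>i\<close> is dual to the simple reflection \<open>s\<^sub>i\<close>, that is \<open>\<alpha> \<bullet> f\<^sub>i(v) = s\<^sub>i \<alpha> \<bullet> v\<close>, and \<open>s\<^sub>i\<close> permutes the
  positive roots other than \<open>\<alpha>\<^sub>i\<close>.  Hence a move from an allowed configuration neither creates nor
  destroys the condition \<open>(\<ast>)\<close>, and it removes exactly one root from the set of positive roots that
  are negative on \<open>v\<close>.  When this set is finite, as it is in the Dynkin case and in the extended case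
  with \<open>\<delta> \<bullet> v > 0\<close>, every play ends, and \<open>(\<ast>)\<close> decides how.  If \<open>(\<ast>)\<close> fails in an infinite play,
  then some vertex is eventually never fired, and the same count over the finitely many roots
  vanishing there is a contradiction.  If \<open>(\<ast>)\<close> holds and \<open>\<delta> \<bullet> v = 0\<close>, all amplitudes stay in the
  set of values of roots on \<open>v\<close>, finite because roots are finite in number modulo \<open>\<delta>\<close>.

  Both types of diagram carry positive integer weights \<open>d\<close> such that the weights of the neighbours of
  \<open>i\<close> add up to at most \<open>2 d\<^sub>i\<close>; this exhibits the Cartan form as a weighted sum of squares.
\<close>

section \<open>Finite sets of vectors and of bounded integers\<close>

lemma finite_vec_entries:
  assumes "finite S"
  shows "finite {v :: 'a^'n. \<forall>i. v $ i \<in> S}"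
proof -
  have "finite ((UNIV :: 'n set) \<rightarrow>\<^sub>E S)"
    using assms by (intro finite_PiE) auto
  moreover have "vec_nth ` {v :: 'a^'n. \<forall>i. v $ i \<in> S} \<subseteq> (UNIV :: 'n set) \<rightarrow>\<^sub>E S"
    by auto
  ultimately have "finite (vec_nth ` {v :: 'a^'n. \<forall>i. v $ i \<in> S})"
    by (rule finite_subset[rotated])
  then show ?thesis
    by (rule finite_imageD) (simp add: inj_on_def vec_eq_iff)
qed

lemma finite_Ints_bounded: "finite {x :: real. x \<in> \<int> \<and> \<bar>x\<bar> \<le> M}"
proof -
  have "{x :: real. x \<in> \<int> \<and> \<bar>x\<bar> \<le> M} \<subseteq> real_of_int ` {\<lfloor>- M\<rfloor>..\<lceil>M\<rceil>}"
  proof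
    fix x :: real
    assume "x \<in> {x. x \<in> \<int> \<and> \<bar>x\<bar> \<le> M}"
    then obtain n where "x = of_int n" "\<bar>x\<bar> \<le> M"
      by (auto elim: Ints_cases)
    then have "n \<in> {\<lfloor>- M\<rfloor>..\<lceil>M\<rceil>}"
      by (auto simp: floor_le_iff le_ceiling_iff abs_le_iff)
    then show "x \<in> real_of_int ` {\<lfloor>- M\<rfloor>..\<lceil>M\<rceil>}"
      using \<open>x = of_int n\<close> by auto
  qed
  then show ?thesis
    by (rule finite_subset) simp
qed

section \<open>The Cartan form and the simple reflections\<close>

lemma cartan_entry_sum:
  assumes "\<not> adj i i"
  shows "(\<Sum>j\<in>UNIV. cartan_entry adj i j * g j) = 2 * g i - (\<Sum>j | adj i j. g (j :: 'n::finite))"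
proof -
  have "(\<Sum>j\<in>UNIV. cartan_entry adj i j * g j) =
      (\<Sum>j\<in>UNIV. (if j = i then 2 * g j else 0) - (if adj i j then g j else 0))"
    using assms by (intro sum.cong) (auto simp: cartan_entry_def)
  also have "\<dots> = 2 * g i - (\<Sum>j | adj i j. g j)"
    by (simp add: sum_subtractf sum.If_cases)
  finally show ?thesis .
qed

lemma bilinear_cartan_form: "bilinear (cartan_form adj)"
  unfolding bilinear_def linear_iff cartan_form_def
  by (simp add: algebra_simps sum.distrib sum_distrib_left)

lemmas cartan_form_simps =
  bilinear_ladd[OF bilinear_cartan_form] bilinear_radd[OF bilinear_cartan_form]
  bilinear_lsub[OF bilinear_cartan_form] bilinear_rsub[OF bilinear_cartan_form]
  bilinear_lmul[OF bilinear_cartan_form] bilinear_rmul[OF bilinear_cartan_form]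

text \<open>The simple reflection \<open>s\<^sub>i\<close>. Simple roots have norm 2, so the usual
  coefficient \<open>2 \<langle>x, \<alpha>\<^sub>i\<rangle> / \<langle>\<alpha>\<^sub>i,
  \<alpha>\<^sub>i\<rangle>\<close> is just the form itself.\<close>

definition reflect :: "('n::finite \<Rightarrow> 'n \<Rightarrow> bool) \<Rightarrow> 'n \<Rightarrow> real^'n \<Rightarrow> real^'n" where
  "reflect adj i x = x - cartan_form adj x (axis i 1) *\<^sub>R axis i 1"

locale simple_graph =
  fixes adj :: "'n::finite \<Rightarrow> 'n \<Rightarrow> bool"
  assumes adj_sym: "adj i j \<Longrightarrow> adj j i"
    and adj_irrefl: "\<not> adj i i"
begin

lemma adj_commute: "adj i j \<longleftrightarrow> adj j i"
  using adj_sym by blast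

lemma cartan_form_commute: "cartan_form adj x y = cartan_form adj y x"
proof -
  have "cartan_form adj x y = (\<Sum>j\<in>UNIV. \<Sum>i\<in>UNIV. x $ i * cartan_entry adj i j * y $ j)"
    unfolding cartan_form_def by (rule sum.swap)
  also have "\<dots> = cartan_form adj y x"
    unfolding cartan_form_def cartan_entry_def
    by (intro sum.cong refl) (use adj_commute in auto)
  finally show ?thesis .
qed

lemma cartan_form_eq:
  "cartan_form adj x y = (\<Sum>i\<in>UNIV. x $ i * (2 * y $ i - (\<Sum>j | adj i j. y $ j)))"
proof -
  have "cartan_form adj x y = (\<Sum>i\<in>UNIV. x $ i * (\<Sum>j\<in>UNIV. cartan_entry adj i j * y $ j))"
    unfolding cartan_form_def by (simp add: sum_distrib_left mult.assoc)
  then show ?thesis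
    by (simp add: cartan_entry_sum adj_irrefl)
qed

lemma cartan_form_axis_left:
  "cartan_form adj (axis i 1) y = 2 * y $ i - (\<Sum>j | adj i j. y $ j)"
proof -
  have "cartan_form adj (axis i 1) y =
      (\<Sum>k\<in>UNIV. if k = i then 2 * y $ k - (\<Sum>j | adj k j. y $ j) else 0)"
    unfolding cartan_form_eq by (intro sum.cong) (auto simp: axis_def)
  then show ?thesis by simp
qed

lemma cartan_form_axis:
  "cartan_form adj x (axis i 1) = 2 * x $ i - (\<Sum>j | adj i j. x $ j)"
  using cartan_form_axis_left cartan_form_commute by simp

lemma cartan_form_axis_axis: "cartan_form adj (axis i 1) (axis i 1) = 2"
proof -
  have "(\<Sum>j | adj i j. axis i (1::real) $ j) = 0"
    by (intro sum.neutral) (auto simp: axis_def adj_irrefl)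
  then show ?thesis
    unfolding cartan_form_axis[of "axis i 1"] by simp
qed

text \<open>Used to find a simple root that pairs positively with a given positive root.\<close>

lemma cartan_form_self:
  "cartan_form adj x x = (\<Sum>i\<in>UNIV. x $ i * cartan_form adj x (axis i 1))"
  unfolding cartan_form_axis by (rule cartan_form_eq)

lemma reflect_nth:
  "reflect adj i x $ j = (if j = i then x $ i - cartan_form adj x (axis i 1) else x $ j)"
  by (simp add: reflect_def axis_def)

lemma reflect_axis: "reflect adj i (axis i 1) = - axis i 1"
  by (simp add: reflect_def cartan_form_axis_axis scaleR_2)

lemma reflect_reflect: "reflect adj i (reflect adj i x) = x"
  by (simp add: reflect_def cartan_form_simps cartan_form_axis_axis algebra_simps)

lemma cartan_form_reflect:
  "cartan_form adj (reflect adj i x) (reflect adj i x) = cartan_form adj x x"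
  using cartan_form_commute[of x "axis i 1"]
  by (simp add: reflect_def cartan_form_simps cartan_form_axis_axis algebra_simps)

text \<open>When \<open>v $ i < 0\<close>, the value of \<open>x\<close> does not increase exactly
  if \<open>x\<close> pairs nonpositively with the fired simple root.\<close>

lemma inner_fire_diff:
  "x \<bullet> fire adj i v = x \<bullet> v - v $ i * cartan_form adj x (axis i 1)"
proof -
  have "x \<bullet> fire adj i v =
      (\<Sum>j\<in>UNIV. x $ j * v $ j + ((if j = i then - (2 * x $ j * v $ j) else 0) +
        (if adj i j then x $ j * v $ i else 0)))"
    unfolding inner_vec_def
    by (intro sum.cong) (auto simp: fire_def adj_irrefl algebra_simps)
  also have "\<dots> = x \<bullet> v + (- 2 * x $ i * v $ i + (\<Sum>j | adj i j. x $ j * v $ i))"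
    by (simp add: sum.distrib sum.If_cases inner_vec_def)
  also have "\<dots> = x \<bullet> v - v $ i * cartan_form adj x (axis i 1)"
    unfolding cartan_form_axis by (simp add: algebra_simps sum_distrib_left)
  finally show ?thesis .
qed

lemma inner_fire: "x \<bullet> fire adj i v = reflect adj i x \<bullet> v"
  unfolding inner_fire_diff reflect_def
  by (simp add: inner_diff_left inner_axis')

lemma inner_reflect_fire: "reflect adj i x \<bullet> fire adj i v = x \<bullet> v"
  by (simp add: inner_fire reflect_reflect)

lemma axis_positive_root: "axis i 1 \<in> positive_roots adj"
  unfolding positive_roots_def by (simp add: cartan_form_axis_axis) (simp add: axis_def)

text \<open>Roots of either sign: this set is stable under every simple reflection, whereas
  \<open>s\<^sub>i\<close> makes the positive root \<open>\<alpha>\<^sub>i\<close> negative.\<close>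

definition roots :: "(real^'n) set" where
  "roots = {x. (\<forall>i. x $ i \<in> \<int>) \<and> cartan_form adj x x = 2}"

lemma positive_roots_alt: "positive_roots adj = {x \<in> roots. \<forall>i. 0 \<le> x $ i}"
  unfolding positive_roots_def roots_def by (auto simp: Nats_altdef2)

lemma reflect_root: "x \<in> roots \<Longrightarrow> reflect adj i x \<in> roots"
  by (auto simp: roots_def cartan_form_reflect reflect_nth cartan_form_axis
      intro!: Ints_diff Ints_mult Ints_sum)

text \<open>On the compact set of unit vectors of \<open>S\<close> the form has a positive minimum
  \<open>c\<close>, so a root in \<open>S\<close> has squared norm at most \<open>2 / c\<close>;
  only finitely many integral vectors do. \<open>S\<close> will be the whole space or a coordinate
  hyperplane.\<close>

lemma finite_roots_on:
  assumes "closed S" and scale: "\<And>c x. x \<in> S \<Longrightarrow> c *\<^sub>R x \<in> S"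
    and pos: "\<And>x. x \<in> S \<Longrightarrow> x \<noteq> 0 \<Longrightarrow> 0 < cartan_form adj x x"
  shows "finite (roots \<inter> S)"
proof -
  have cont: "continuous_on A (\<lambda>x. cartan_form adj x x)" for A
    unfolding cartan_form_def by (intro continuous_intros)
  have "\<exists>c>0. \<forall>x\<in>sphere 0 1 \<inter> S. c \<le> cartan_form adj x x"
  proof (cases "sphere 0 1 \<inter> S = {}")
    case False
    have "compact (sphere 0 1 \<inter> S)"
      using \<open>closed S\<close> by (simp add: compact_Int_closed)
    from continuous_attains_inf[OF this False cont] obtain y where
      "y \<in> sphere 0 1 \<inter> S" "\<forall>x\<in>sphere 0 1 \<inter> S. cartan_form adj y y \<le> cartan_form adj x x"
      by blast
    moreover from this have "0 < cartan_form adj y y"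
      by (intro pos) auto
    ultimately show ?thesis by blast
  qed (auto intro: exI[of _ 1])
  then obtain c where "0 < c" and c: "\<And>x. x \<in> sphere 0 1 \<inter> S \<Longrightarrow> c \<le> cartan_form adj x x"
    by blast
  have "\<bar>x $ i\<bar> \<le> sqrt (2 / c)" if x: "x \<in> roots \<inter> S" for x i
  proof -
    have form: "cartan_form adj x x = 2" using x by (simp add: roots_def)
    have "x \<noteq> 0"
    proof
      assume "x = 0"
      then have "cartan_form adj x x = 0" by (simp add: cartan_form_def)
      then show False using form by simp
    qed
    then have "c \<le> cartan_form adj (inverse (norm x) *\<^sub>R x) (inverse (norm x) *\<^sub>R x)"
      using x by (intro c) (auto intro: scale)
    also have "\<dots> = 2 / (norm x)\<^sup>2"
      by (simp add: cartan_form_simps form power2_eq_square divide_simps)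
    finally have "(norm x)\<^sup>2 \<le> 2 / c"
      using \<open>x \<noteq> 0\<close> \<open>0 < c\<close> by (simp add: field_simps)
    then have "norm x \<le> sqrt (2 / c)"
      by (simp add: real_le_rsqrt)
    then show ?thesis
      using component_le_norm_cart[of x i] by linarith
  qed
  then have "roots \<inter> S \<subseteq> {x. \<forall>i. x $ i \<in> {t. t \<in> \<int> \<and> \<bar>t\<bar> \<le> sqrt (2 / c)}}"
    by (auto simp: roots_def)
  then show ?thesis
    by (rule finite_subset) (rule finite_vec_entries[OF finite_Ints_bounded])
qed

end

text \<open>The assumption \<open>edge_invariant_const\<close> is connectedness, in the form in
  which it is applied to the ratios \<open>x $ i / d i\<close>. The assumption
  \<open>d_super\<close> says that the vector \<open>d\<close> pairs nonnegatively with every simple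
  root.\<close>

locale weighted_graph = simple_graph adj for adj :: "'n::finite \<Rightarrow> 'n \<Rightarrow> bool" +
  fixes d :: "'n \<Rightarrow> nat"
  assumes edge_invariant_const: "\<And>f :: 'n \<Rightarrow> real. (\<And>i j. adj i j \<Longrightarrow> f i = f j) \<Longrightarrow> \<exists>c. \<forall>i. f i = c"
    and d_pos: "0 < d i"
    and d_super: "(\<Sum>j | adj i j. d j) \<le> 2 * d i"
begin

section \<open>Semidefiniteness of the Cartan form, null vectors and positive roots\<close>

lemma d_nonzero [simp]: "d i \<noteq> 0"
  using d_pos[of i] by simp

text \<open>Every edge occurs in both directions, hence the division by 2. Expanding the squares
  gives \<open>2 * S - 2 * T\<close>, with \<open>T\<close> the mixed products; the second sum
  restores the diagonal coefficient 2. Both sums are nonnegative.\<close>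

lemma cartan_form_squares:
  "cartan_form adj x x =
     (\<Sum>i\<in>UNIV. \<Sum>j | adj i j. real (d i) * real (d j) * (x $ i / d i - x $ j / d j)\<^sup>2) / 2 +
     (\<Sum>i\<in>UNIV. (x $ i)\<^sup>2 / d i * (2 * real (d i) - (\<Sum>j | adj i j. real (d j))))"
proof -
  define S where "S = (\<Sum>i\<in>UNIV. \<Sum>j | adj i j. (x $ i)\<^sup>2 / d i * d j)"
  define T where "T = (\<Sum>i\<in>UNIV. \<Sum>j | adj i j. x $ i * x $ j)"
  have swap: "(\<Sum>i\<in>UNIV. \<Sum>j | adj i j. (x $ j)\<^sup>2 / d j * d i) = S"
  proof -
    have "(\<Sum>i\<in>UNIV. \<Sum>j | adj i j. (x $ j)\<^sup>2 / d j * d i) =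
        (\<Sum>j\<in>UNIV. \<Sum>i | adj i j. (x $ j)\<^sup>2 / d j * d i)"
      using sum.swap_restrict[of UNIV UNIV "\<lambda>i j. (x $ j)\<^sup>2 / d j * d i" adj] by simp
    also have "\<dots> = S"
      unfolding S_def using adj_commute by simp
    finally show ?thesis .
  qed
  have "(\<Sum>i\<in>UNIV. \<Sum>j | adj i j. real (d i) * real (d j) * (x $ i / d i - x $ j / d j)\<^sup>2) =
      (\<Sum>i\<in>UNIV. \<Sum>j | adj i j. (x $ i)\<^sup>2 / d i * d j + (x $ j)\<^sup>2 / d j * d i - 2 * (x $ i * x $ j))"
    by (intro sum.cong refl) (simp add: power2_eq_square field_simps)
  also have "\<dots> = 2 * S - 2 * T"
    using swap unfolding S_def T_def by (simp add: sum.distrib sum_subtractf sum_distrib_left)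
  finally have "(\<Sum>i\<in>UNIV. \<Sum>j | adj i j. real (d i) * real (d j) * (x $ i / d i - x $ j / d j)\<^sup>2)
      = 2 * S - 2 * T" .
  moreover have "(\<Sum>i\<in>UNIV. (x $ i)\<^sup>2 / d i * (2 * real (d i) - (\<Sum>j | adj i j. real (d j))))
      = (\<Sum>i\<in>UNIV. (x $ i)\<^sup>2 * 2) - S"
    unfolding S_def by (simp add: right_diff_distrib sum_subtractf sum_distrib_left)
  moreover have "cartan_form adj x x = (\<Sum>i\<in>UNIV. (x $ i)\<^sup>2 * 2) - T"
    unfolding cartan_form_eq T_def
    by (simp add: right_diff_distrib sum_subtractf sum_distrib_left power2_eq_square mult.assoc
        mult.commute[of _ "2 :: real"] mult.left_commute[of _ "2 :: real"])
  ultimately show ?thesis by linarith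
qed

lemma d_super_real: "(\<Sum>j | adj i j. real (d j)) \<le> 2 * real (d i)"
  using d_super[of i] by (metis of_nat_le_iff of_nat_mult of_nat_numeral of_nat_sum)

lemma cartan_form_squares_nonneg:
  "0 \<le> (\<Sum>i\<in>UNIV. \<Sum>j | adj i j. real (d i) * real (d j) * (x $ i / d i - x $ j / d j)\<^sup>2)"
  "0 \<le> (\<Sum>i\<in>UNIV. (x $ i)\<^sup>2 / d i * (2 * real (d i) - (\<Sum>j | adj i j. real (d j))))"
  using d_super_real by (auto intro!: sum_nonneg)

lemma cartan_form_nonneg: "0 \<le> cartan_form adj x x"
  unfolding cartan_form_squares using cartan_form_squares_nonneg[of x] by simp

text \<open>Both sums of squares vanish term by term. The first makes \<open>x $ i / d i\<close>
  agree along edges, hence constant by connectedness; the second kills the constant as soon as the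
  weight inequality is strict somewhere.\<close>

lemma null_vector:
  assumes "cartan_form adj x x = 0"
  obtains c :: real where "\<And>i. x $ i = c * d i"
    and "\<And>i. (\<Sum>j | adj i j. d j) < 2 * d i \<Longrightarrow> c = 0"
proof -
  have sq: "(\<Sum>i\<in>UNIV. \<Sum>j | adj i j. real (d i) * real (d j) * (x $ i / d i - x $ j / d j)\<^sup>2) = 0"
    and bd: "(\<Sum>i\<in>UNIV. (x $ i)\<^sup>2 / d i * (2 * real (d i) - (\<Sum>j | adj i j. real (d j)))) = 0"
    using assms cartan_form_squares_nonneg[of x] unfolding cartan_form_squares by linarith+
  have "x $ i / d i = x $ j / d j" if "adj i j" for i j
  proof -
    have "(\<Sum>j | adj i j. real (d i) * real (d j) * (x $ i / d i - x $ j / d j)\<^sup>2) = 0"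
      using sq by (subst (asm) sum_nonneg_eq_0_iff) (auto intro: sum_nonneg)
    then have "real (d i) * real (d j) * (x $ i / d i - x $ j / d j)\<^sup>2 = 0"
      using that by (subst (asm) sum_nonneg_eq_0_iff) auto
    then show ?thesis by simp
  qed
  from edge_invariant_const[of "\<lambda>i. x $ i / d i", OF this] obtain c where "\<And>i. x $ i / d i = c"
    by blast
  then have c: "x $ i = c * d i" for i
    by (simp add: field_simps flip: \<open>\<And>i. x $ i / d i = c\<close>)
  have "c = 0" if less: "(\<Sum>j | adj i j. d j) < 2 * d i" for i
  proof -
    have "(x $ i)\<^sup>2 / d i * (2 * real (d i) - (\<Sum>j | adj i j. real (d j))) = 0"
      using bd d_super_real by (subst (asm) sum_nonneg_eq_0_iff) auto
    moreover have "real (\<Sum>j | adj i j. d j) < real (2 * d i)"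
      using less by (simp only: of_nat_less_iff)
    ultimately show ?thesis
      by (simp add: c)
  qed
  with c show thesis by (rule that)
qed

text \<open>Only coordinate \<open>i\<close> of \<open>y = s\<^sub>i x\<close> can be negative, say
  \<open>-n\<close>. Let \<open>a\<close> be \<open>x\<close> with that coordinate erased. As
  \<open>\<langle>a, \<alpha>\<^sub>i\<rangle> \<le> 0\<close>, expanding
  \<open>2 = \<langle>y, y\<rangle>\<close> gives
  \<open>2 \<ge> \<langle>a, a\<rangle> + 2 n\<^sup>2\<close> with \<open>n \<ge> 1\<close>. So
  \<open>a\<close> is a null vector, a multiple of \<open>d\<close> with a zero coordinate, hence
  zero, and \<open>x\<close> is a multiple of \<open>\<alpha>\<^sub>i\<close> of norm 2.\<close>

lemma positive_root_reflect:
  assumes x: "x \<in> positive_roots adj" and "x \<noteq> axis i 1"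
  shows "reflect adj i x \<in> positive_roots adj"
proof (rule ccontr)
  assume neg: "reflect adj i x \<notin> positive_roots adj"
  have int: "x $ i \<in> \<int>" and nonneg: "0 \<le> x $ j" for j
    using x by (auto simp: positive_roots_alt roots_def)
  define y where "y = reflect adj i x"
  have y: "y \<in> roots"
    using x by (simp add: y_def positive_roots_alt reflect_root)
  have "y $ j = x $ j" if "j \<noteq> i" for j
    using that by (simp add: y_def reflect_nth)
  then have yi: "y $ i < 0"
    using neg y nonneg unfolding positive_roots_alt y_def[symmetric] mem_Collect_eq
    by (metis not_le)
  define n where "n = - y $ i"
  have n: "n \<ge> 1"
    using y yi unfolding n_def roots_def by (auto elim!: Ints_cases dest!: spec[of _ i])
  define a where "a = y + n *\<^sub>R axis i 1"
  have a: "a $ j = (if j = i then 0 else x $ j)" for j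
    by (simp add: a_def n_def y_def reflect_nth axis_def)
  have "cartan_form adj a (axis i 1) \<le> 0"
    unfolding cartan_form_axis using nonneg by (simp add: a sum_nonneg)
  moreover have "y = a - n *\<^sub>R axis i 1"
    by (simp add: a_def)
  then have "cartan_form adj y y =
      cartan_form adj a a - 2 * n * cartan_form adj a (axis i 1) + 2 * n\<^sup>2"
    using cartan_form_commute[of "axis i 1" a]
    by (simp only: cartan_form_simps cartan_form_axis_axis)
      (simp add: power2_eq_square algebra_simps)
  moreover have "cartan_form adj y y = 2"
    using y by (simp add: roots_def)
  moreover have "n\<^sup>2 \<ge> 1"
    using n by simp
  ultimately have "cartan_form adj a a \<le> 0"
    using n by (smt (verit) mult_nonneg_nonpos)
  then have "cartan_form adj a a = 0"
    using cartan_form_nonneg[of a] by simp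
  then obtain c :: real where c: "\<And>j. a $ j = c * d j"
    using null_vector by blast
  then have "c = 0"
    using a[of i] d_pos[of i] by simp
  have "x $ j = 0" if "j \<noteq> i" for j
    using a[of j] c[of j] \<open>c = 0\<close> that by simp
  then have "x = x $ i *\<^sub>R axis i 1"
    by (simp add: vec_eq_iff axis_def)
  moreover have "cartan_form adj x x = 2"
    using x by (simp add: positive_roots_def)
  moreover have "cartan_form adj (t *\<^sub>R axis i 1) (t *\<^sub>R axis i 1) = 2 * t\<^sup>2" for t
    by (simp add: cartan_form_simps cartan_form_axis_axis power2_eq_square)
  ultimately have "(x $ i)\<^sup>2 = 1"
    by (metis mult_cancel_left2 zero_neq_numeral)
  then have "x $ i = 1"
    using nonneg[of i] by (simp add: power2_eq_1_iff)
  then show False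
    using \<open>x = x $ i *\<^sub>R axis i 1\<close> \<open>x \<noteq> axis i 1\<close> by simp
qed

text \<open>Null vectors are multiples of \<open>d\<close>, which has no zero coordinate, so the
  form is positive definite on this hyperplane even if it is degenerate on the whole space.\<close>

lemma finite_roots_vanishing: "finite {x \<in> roots. x $ i = 0}"
proof -
  have "finite (roots \<inter> {x. x $ i = 0})"
  proof (rule finite_roots_on)
    show "closed {x :: real^'n. x $ i = 0}"
      by (intro closed_Collect_eq continuous_intros)
    fix x :: "real^'n"
    assume x: "x \<in> {x. x $ i = 0}" "x \<noteq> 0"
    have "cartan_form adj x x \<noteq> 0"
    proof
      assume "cartan_form adj x x = 0"
      then obtain c :: real where c: "\<And>j. x $ j = c * d j"
        using null_vector by blast
      then have "c = 0"
        using x d_pos[of i] c[of i] by auto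
      then show False
        using x c by (simp add: vec_eq_iff)
    qed
    then show "0 < cartan_form adj x x"
      using cartan_form_nonneg[of x] by simp
  qed simp
  then show ?thesis
    by (simp add: Int_def)
qed

section \<open>The game\<close>

abbreviation bounded_on_roots :: "real^'n \<Rightarrow> bool" where
  "bounded_on_roots v \<equiv> \<forall>\<alpha>\<in>positive_roots adj. \<alpha> \<bullet> v \<ge> -1"

text \<open>The reflection matches up the positive roots other than \<open>\<alpha>\<^sub>i\<close>,
  and the value of \<open>\<alpha>\<^sub>i\<close> goes from \<open>v $ i\<close> to
  \<open>- v $ i\<close>, both at least -1. By the equivalence, (\<ast>) may be tested at any time
  of a play.\<close>

lemma bounded_on_roots_fire:
  assumes "v $ i < 0" "-1 \<le> v $ i"
  shows "bounded_on_roots (fire adj i v) \<longleftrightarrow> bounded_on_roots v"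
proof -
  have "- 1 \<le> x \<bullet> fire adj i v" if "bounded_on_roots v" "x \<in> positive_roots adj" for x
  proof (cases "x = axis i 1")
    case True
    then show ?thesis using assms by (simp add: inner_axis' fire_def)
  next
    case False
    then show ?thesis
      using that positive_root_reflect by (simp add: inner_fire)
  qed
  moreover have "- 1 \<le> x \<bullet> v" if "bounded_on_roots (fire adj i v)" "x \<in> positive_roots adj" for x
  proof (cases "x = axis i 1")
    case True
    then show ?thesis using assms by (simp add: inner_axis')
  next
    case False
    then show ?thesis
      using that positive_root_reflect inner_reflect_fire by metis
  qed
  ultimately show ?thesis by blast
qed

lemma nonneg_bounded_on_roots: "nonneg v \<Longrightarrow> bounded_on_roots v"
proof
  fix x
  assume "nonneg v" "x \<in> positive_roots adj"
  then have "0 \<le> x \<bullet> v"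
    unfolding inner_vec_def by (auto simp: nonneg_def positive_roots_alt intro!: sum_nonneg)
  then show "-1 \<le> x \<bullet> v" by simp
qed

lemma bounded_on_roots_not_forbidden: "bounded_on_roots v \<Longrightarrow> \<not> forbidden v"
  unfolding forbidden_def
  by (metis axis_positive_root inner_axis' inner_real_def lambda_one not_less real_inner_1_left)

lemma play_bounded_on_roots:
  assumes "play adj v p"
  shows "bounded_on_roots (p k) \<longleftrightarrow> bounded_on_roots v"
proof (induction k)
  case 0
  then show ?case using assms by (simp add: play_def)
next
  case (Suc k)
  show ?case
  proof (cases "game_over (p k)")
    case True
    then show ?thesis using assms Suc by (simp add: play_def)
  next
    case False
    then obtain i where "p k $ i < 0" "p (Suc k) = fire adj i (p k)"
      using assms unfolding play_def by meson
    moreover have "-1 \<le> p k $ i"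
      using False by (auto simp: game_over_def forbidden_def not_less)
    ultimately show ?thesis
      using Suc bounded_on_roots_fire by simp
  qed
qed

text \<open>The reflection injects the roots negative after the move into those negative before it
  and misses \<open>axis i 1\<close>, which was negative. \<open>Q\<close> will be the set of all
  positive roots, or of those vanishing at a vertex that is no longer fired.\<close>

lemma card_negative_roots_fire:
  assumes "v $ i < 0" "finite {x \<in> Q. x \<bullet> v < 0}" "axis i 1 \<in> Q"
    and Q: "\<And>x. x \<in> Q \<Longrightarrow> x \<noteq> axis i 1 \<Longrightarrow> reflect adj i x \<in> Q"
    and "Q \<subseteq> positive_roots adj"
  shows "finite {x \<in> Q. x \<bullet> fire adj i v < 0}"
    and "card {x \<in> Q. x \<bullet> fire adj i v < 0} < card {x \<in> Q. x \<bullet> v < 0}"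
proof -
  let ?N = "{x \<in> Q. x \<bullet> v < 0}" and ?M = "{x \<in> Q. x \<bullet> fire adj i v < 0}"
  have inj: "inj_on (reflect adj i) ?M"
    by (metis inj_onI reflect_reflect)
  have img: "reflect adj i ` ?M \<subseteq> ?N - {axis i 1}"
  proof (clarify, intro DiffI)
    fix x
    assume x: "x \<in> Q" "x \<bullet> fire adj i v < 0"
    have "x \<noteq> axis i 1"
      using x \<open>v $ i < 0\<close> by (auto simp: inner_axis' fire_def)
    with x Q show "reflect adj i x \<in> ?N"
      by (simp add: inner_fire)
    show "reflect adj i x \<notin> {axis i 1}"
    proof
      assume "reflect adj i x \<in> {axis i 1}"
      then have "x = - axis i 1"
        by (metis reflect_axis reflect_reflect singletonD)
      moreover have "0 \<le> x $ i"
        using x \<open>Q \<subseteq> positive_roots adj\<close> by (auto simp: positive_roots_alt)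
      ultimately show False by (simp add: axis_def)
    qed
  qed
  then show fin: "finite ?M"
    using inj assms(2) by (meson finite_Diff finite_imageD finite_subset)
  have "card ?M \<le> card (?N - {axis i 1})"
    using card_inj_on_le[OF inj img] assms(2) by simp
  also have "\<dots> < card ?N"
    using assms by (intro card_Diff1_less) (auto simp: inner_axis')
  finally show "card ?M < card ?N" .
qed

text \<open>The number of negative roots in \<open>Q\<close> drops with every move, so its initial
  value bounds the number of moves.\<close>

lemma no_infinite_firing:
  assumes step: "\<And>k. q k $ i k < 0" "\<And>k. q (Suc k) = fire adj (i k) (q k)"
    and "\<And>k. axis (i k) 1 \<in> Q"
    and "\<And>k x. x \<in> Q \<Longrightarrow> x \<noteq> axis (i k) 1 \<Longrightarrow> reflect adj (i k) x \<in> Q"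
    and "Q \<subseteq> positive_roots adj"
    and fin: "finite {x \<in> Q. x \<bullet> q 0 < 0}"
  shows False
proof -
  define N where "N k = {x \<in> Q. x \<bullet> q k < 0}" for k
  have finN: "finite (N k)" for k
  proof (induction k)
    case (Suc k)
    then show ?case
      unfolding N_def step(2) by (intro card_negative_roots_fire) (use assms in auto)
  qed (use fin N_def in simp)
  have less: "card (N (Suc k)) < card (N k)" for k
    unfolding N_def step(2)
    by (intro card_negative_roots_fire) (use assms finN N_def in auto)
  have "card (N k) + k \<le> card (N 0)" for k
  proof (induction k)
    case (Suc k)
    then show ?case using less[of k] by simp
  qed simp
  from this[of "Suc (card (N 0))"] show False by simp
qed

lemma infinite_play:
  assumes "play adj v p" "\<And>k. \<not> game_over (p k)"
  shows "\<exists>i. \<forall>k. p k $ i k < 0 \<and> -1 \<le> p k $ i k \<and> p (Suc k) = fire adj (i k) (p k)"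
proof -
  have "\<forall>k. \<exists>i. p k $ i < 0 \<and> -1 \<le> p k $ i \<and> p (Suc k) = fire adj i (p k)"
    using assms unfolding play_def game_over_def forbidden_def by (meson not_less)
  then show ?thesis by (rule choice)
qed

text \<open>Supplies the play whose existence \<open>winning\<close> demands.\<close>

lemma ex_play: "\<exists>p. play adj v p"
proof -
  define step where "step v = (if game_over v then v else fire adj (SOME i. v $ i < 0) v)" for v
  have "v $ (SOME i. v $ i < 0) < 0" if "\<not> game_over v" for v :: "real^'n"
    using that unfolding game_over_def nonneg_def by (metis not_less someI)
  then have "play adj v (\<lambda>k. (step ^^ k) v)"
    unfolding play_def by (auto simp: step_def)
  then show ?thesis by blast
qed

text \<open>Any play will do: the count forces it to end, and (\<ast>) rules out a forbidden
  end.\<close>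

lemma finite_negative_roots_winning:
  assumes "bounded_on_roots v" and fin: "finite {x \<in> positive_roots adj. x \<bullet> v < 0}"
  shows "winning adj v"
proof -
  obtain p where p: "play adj v p"
    using ex_play by blast
  have "\<exists>k. game_over (p k)"
  proof (rule ccontr)
    assume "\<nexists>k. game_over (p k)"
    then have "\<not> game_over (p k)" for k by blast
    then obtain i where i: "\<forall>k. p k $ i k < 0 \<and> -1 \<le> p k $ i k \<and> p (Suc k) = fire adj (i k) (p k)"
      by (rule exE[OF infinite_play[OF p]])
    show False
    proof (rule no_infinite_firing[of p i "positive_roots adj"])
      show "finite {x \<in> positive_roots adj. x \<bullet> p 0 < 0}"
        using fin p by (simp add: play_def)
    qed (use i positive_root_reflect axis_positive_root in auto)
  qed
  then obtain k where "game_over (p k)" ..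
  moreover have "\<not> forbidden (p k)"
    using play_bounded_on_roots[OF p] assms(1) by (intro bounded_on_roots_not_forbidden) simp
  ultimately show ?thesis
    using p unfolding winning_def game_over_def by blast
qed

lemma winning_bounded_on_roots: "winning adj v \<Longrightarrow> bounded_on_roots v"
  unfolding winning_def using play_bounded_on_roots nonneg_bounded_on_roots by blast

text \<open>
  Among all pairs of a time \<open>k\<close> and a positive root \<open>\<beta>\<close> with \<open>\<beta> \<bullet> q k < -1\<close>, take one with \<open>\<beta>\<close> of
  minimal height.  Firing a vertex \<open>j\<close> with \<open>\<langle>\<beta>, \<alpha>\<^sub>j\<rangle> > 0\<close> would yield such a pair with the lower root
  \<open>s\<^sub>j \<beta>\<close>, and firing any other vertex does not increase \<open>\<beta> \<bullet> q k\<close>; so no such \<open>j\<close> is fired again.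
  There is one, since \<open>\<langle>\<beta>, \<beta>\<rangle> > 0\<close>.
\<close>

lemma unbounded_vertex_abandoned:
  assumes step: "\<And>k. q k $ i k < 0" "\<And>k. -1 \<le> q k $ i k" "\<And>k. q (Suc k) = fire adj (i k) (q k)"
    and "\<not> bounded_on_roots (q 0)"
  shows "\<exists>j K. \<forall>k\<ge>K. i k \<noteq> j"
proof -
  \<comment> \<open>Heights are taken in the naturals so that a least one exists; the floor is exact
    on the integral entries of a root.\<close>
  define height where "height x = (\<Sum>j\<in>UNIV. nat \<lfloor>x $ j\<rfloor>)" for x :: "real^'n"
  have height: "real (height x) = (\<Sum>j\<in>UNIV. x $ j)" if "x \<in> positive_roots adj" for x
    unfolding height_def of_nat_sum using that
    by (intro sum.cong) (auto simp: positive_roots_alt roots_def)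
  define P where "P = (\<lambda>(k, x). x \<in> positive_roots adj \<and> x \<bullet> q k < -1)"
  obtain x where "P (0, x)"
    using assms(4) by (auto simp: P_def not_le)
  then obtain m where "P m" and m: "\<And>y. P y \<Longrightarrow> height (snd m) \<le> height (snd y)"
    using ex_has_least_nat[of P _ "\<lambda>m. height (snd m)"] by blast
  obtain K b where Kb: "m = (K, b)" by fastforce
  have b: "b \<in> positive_roots adj" "b \<bullet> q K < -1"
    using \<open>P m\<close> by (auto simp: P_def Kb)
  have le: "cartan_form adj b (axis (i k) 1) \<le> 0" if "b \<bullet> q k < -1" for k
  proof (rule ccontr)
    assume pos: "\<not> cartan_form adj b (axis (i k) 1) \<le> 0"
    \<comment> \<open>The fired amplitude is at least -1, while \<open>b\<close> takes a value below
      -1.\<close>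
    have "b \<noteq> axis (i k) 1"
      using that step(2)[of k] by (auto simp: inner_axis')
    then have r: "reflect adj (i k) b \<in> positive_roots adj"
      using b positive_root_reflect by blast
    then have "P (Suc k, reflect adj (i k) b)"
      using that by (simp add: P_def step(3) inner_reflect_fire)
    then have "height b \<le> height (reflect adj (i k) b)"
      using m by (fastforce simp: Kb)
    then have "(\<Sum>j\<in>UNIV. b $ j) \<le> (\<Sum>j\<in>UNIV. reflect adj (i k) b $ j)"
      using height b r by (metis of_nat_le_iff)
    also have "\<dots> = (\<Sum>j\<in>UNIV. b $ j - (if j = i k then cartan_form adj b (axis (i k) 1) else 0))"
      by (intro sum.cong) (auto simp: reflect_nth)
    also have "\<dots> = (\<Sum>j\<in>UNIV. b $ j) - cartan_form adj b (axis (i k) 1)"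
      by (simp add: sum_subtractf)
    finally show False using pos by simp
  qed
  have stay: "b \<bullet> q k < -1" if "K \<le> k" for k
    using that
  proof (induction k rule: dec_induct)
    case (step k)
    have "0 \<le> q k $ i k * cartan_form adj b (axis (i k) 1)"
      using le[OF step(3)] assms(1)[of k] by (simp add: mult_nonpos_nonpos)
    then show ?case
      using step(3) by (simp add: assms(3) inner_fire_diff)
  qed (use b in simp)
  obtain j where j: "cartan_form adj b (axis j 1) > 0"
  proof (rule ccontr)
    assume "\<not> thesis"
    then have "cartan_form adj b (axis j 1) \<le> 0" for j
      using that by (meson not_less)
    then have "cartan_form adj b b \<le> 0"
      unfolding cartan_form_self using b(1)
      by (intro sum_nonpos) (auto simp: positive_roots_alt mult_nonneg_nonpos)
    then show False
      using b(1) by (simp add: positive_roots_def)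
  qed
  have "i k \<noteq> j" if "K \<le> k" for k
    using le[OF stay[OF that]] j by auto
  then show ?thesis by blast
qed

text \<open>Finiteness enters only through the roots vanishing at one vertex, so one argument serves
  both types of diagram.\<close>

lemma not_bounded_on_roots_losing:
  assumes "\<not> bounded_on_roots v"
  shows "losing adj v"
  unfolding losing_def
proof (intro allI impI, rule ccontr)
  fix p
  assume p: "play adj v p" and "\<nexists>k. forbidden (p k)"
  moreover have "\<not> nonneg (p k)" for k
    using assms nonneg_bounded_on_roots play_bounded_on_roots[OF p] by blast
  ultimately have "\<not> game_over (p k)" for k
    by (simp add: game_over_def)
  then obtain i where "\<forall>k. p k $ i k < 0 \<and> -1 \<le> p k $ i k \<and> p (Suc k) = fire adj (i k) (p k)"
    by (rule exE[OF infinite_play[OF p]])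
  then have i: "\<And>k. p k $ i k < 0" "\<And>k. -1 \<le> p k $ i k"
    "\<And>k. p (Suc k) = fire adj (i k) (p k)"
    by auto
  have "\<not> bounded_on_roots (p 0)"
    using assms play_bounded_on_roots[OF p] by blast
  then obtain j K where j: "\<And>k. K \<le> k \<Longrightarrow> i k \<noteq> j"
    using unbounded_vertex_abandoned[where q = p and i = i, OF i] by blast
  \<comment> \<open>Reflections in vertices other than \<open>j\<close> keep coordinate
    \<open>j\<close>, so \<open>Q\<close> is stable under all moves from time \<open>K\<close> on;
    the count is applied to that tail.\<close>
  define Q where "Q = {x \<in> positive_roots adj. x $ j = 0}"
  have "finite Q"
    unfolding Q_def positive_roots_alt
    by (rule finite_subset[OF _ finite_roots_vanishing[of j]]) auto
  moreover have "axis (i (k + K)) 1 \<in> Q" for k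
    using j[of "k + K"] axis_positive_root by (auto simp: Q_def axis_def)
  moreover have "reflect adj (i (k + K)) x \<in> Q" if "x \<in> Q" "x \<noteq> axis (i (k + K)) 1" for k x
    using that j[of "k + K"] positive_root_reflect by (auto simp: Q_def reflect_nth)
  moreover have "Q \<subseteq> positive_roots adj"
    by (auto simp: Q_def)
  ultimately show False
    using i(1,3) no_infinite_firing[of "\<lambda>k. p (k + K)" "\<lambda>k. i (k + K)" Q] by simp
qed

end

section \<open>Graphs of finite type\<close>

locale finite_type_graph = weighted_graph +
  assumes d_strict: "\<exists>i. (\<Sum>j | adj i j. d j) < 2 * d i"
begin

text \<open>One strict weight inequality leaves zero as the only null vector, so the form is
  positive definite on the whole space.\<close>

lemma finite_positive_roots: "finite (positive_roots adj)"
proof -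
  have "finite (roots \<inter> UNIV)"
  proof (rule finite_roots_on)
    fix x :: "real^'a"
    assume "x \<noteq> 0"
    have "cartan_form adj x x \<noteq> 0"
    proof
      assume "cartan_form adj x x = 0"
      then obtain c :: real where "\<And>j. x $ j = c * d j" "c = 0"
        using null_vector d_strict by metis
      then show False
        using \<open>x \<noteq> 0\<close> by (simp add: vec_eq_iff)
    qed
    then show "0 < cartan_form adj x x"
      using cartan_form_nonneg[of x] by simp
  qed auto
  then show ?thesis
    unfolding positive_roots_alt by simp
qed

lemma winning_iff: "winning adj v \<longleftrightarrow> bounded_on_roots v"
  using winning_bounded_on_roots finite_negative_roots_winning finite_positive_roots by auto

end

section \<open>Graphs of affine type\<close>

locale affine_type_graph = weighted_graph +
  assumes d_eq: "(\<Sum>j | adj i j. d j) = 2 * d i"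
    and d_one: "\<exists>i. d i = 1"
begin

text \<open>This vector turns out to be \<delta>. The vertex of weight one makes it primitive and
  allows a root to be cleared at that vertex by an integral multiple of it.\<close>

definition dvec where "dvec = (\<chi> i. real (d i))"

lemma cartan_form_dvec: "cartan_form adj x dvec = 0"
proof -
  have "(\<Sum>j | adj i j. dvec $ j) = 2 * dvec $ i" for i
    using d_eq[of i] unfolding dvec_def by simp (metis of_nat_mult of_nat_numeral of_nat_sum)
  then show ?thesis
    unfolding cartan_form_eq by simp
qed

lemma cartan_form_dvec_left: "cartan_form adj dvec x = 0"
  using cartan_form_dvec cartan_form_commute by simp

lemma cartan_form_kernel: "{x. \<forall>y. cartan_form adj x y = 0} = span {dvec}"
proof
  show "span {dvec} \<subseteq> {x. \<forall>y. cartan_form adj x y = 0}"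
    by (auto simp: span_singleton cartan_form_simps cartan_form_dvec_left)
  show "{x. \<forall>y. cartan_form adj x y = 0} \<subseteq> span {dvec}"
  proof
    fix x
    assume "x \<in> {x. \<forall>y. cartan_form adj x y = 0}"
    then have "cartan_form adj x x = 0" by simp
    then obtain c :: real where "\<And>i. x $ i = c * d i"
      using null_vector by metis
    then have "x = c *\<^sub>R dvec"
      by (simp add: vec_eq_iff dvec_def)
    then show "x \<in> span {dvec}"
      by (simp add: span_base span_mul)
  qed
qed

lemma is_delta_dvec: "is_delta adj dvec"
proof -
  have "Gcd (range d) = 1"
    using d_one by (metis Gcd_dvd nat_dvd_1_iff_1 rangeI)
  then show ?thesis
    unfolding is_delta_def cartan_form_kernel
    by (auto simp: dvec_def d_pos intro!: exI[of _ d])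
qed

text \<open>At a vertex \<open>i\<close> of weight one the factor between \<open>e\<close> and
  \<open>dvec\<close> is read off as the integer \<open>m i\<close>. It divides all coordinates of
  \<open>e\<close>, so it is 1 by primitivity.\<close>

lemma is_delta_unique:
  assumes "is_delta adj e"
  shows "e = dvec"
proof -
  obtain m where m: "\<And>i. e $ i = real (m i)" "Gcd (range m) = 1" and "span {e} = span {dvec}"
    using assms unfolding is_delta_def cartan_form_kernel by blast
  then have "e \<in> span {dvec}"
    by (metis insertI1 span_base)
  then obtain c where c: "e = c *\<^sub>R dvec"
    by (auto simp: span_singleton)
  obtain i where "d i = 1"
    using d_one by blast
  then have "c = real (m i)"
    using m(1)[of i] by (simp add: c dvec_def)
  then have "real (m j) = real (m i * d j)" for j
    using m(1)[of j] by (simp add: c dvec_def)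
  then have "m j = m i * d j" for j
    using of_nat_eq_iff by blast
  then have "m i dvd Gcd (range m)"
    by (intro Gcd_greatest) (metis dvd_triv_left rangeE)
  then have "m i = 1"
    using m(2) by simp
  then show ?thesis
    using c \<open>c = real (m i)\<close> by simp
qed

lemma delta_eq: "delta adj = dvec"
  unfolding delta_def using is_delta_dvec is_delta_unique by blast

lemma reflect_dvec: "reflect adj i dvec = dvec"
  by (simp add: reflect_def cartan_form_dvec_left)

lemma root_shift_dvec: "x \<in> roots \<Longrightarrow> c \<in> \<int> \<Longrightarrow> x + c *\<^sub>R dvec \<in> roots"
  unfolding roots_def mem_Collect_eq
  by (simp add: cartan_form_simps cartan_form_dvec cartan_form_dvec_left) (simp add: dvec_def)

text \<open>Since \<delta> lies in the kernel, shifting by its integral multiples preserves roots.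
  With \<open>finite_roots_vanishing\<close>, roots are finite in number modulo \<delta>.\<close>

lemma root_decompose:
  obtains i where "\<And>x. x \<in> roots \<Longrightarrow> \<exists>y\<in>{y \<in> roots. y $ i = 0}. x = y + (x $ i) *\<^sub>R dvec"
proof -
  obtain i where i: "d i = 1"
    using d_one by blast
  have "\<exists>y\<in>{y \<in> roots. y $ i = 0}. x = y + (x $ i) *\<^sub>R dvec" if "x \<in> roots" for x
  proof
    have "x $ i \<in> \<int>" using that by (simp add: roots_def)
    then show "x + (- (x $ i)) *\<^sub>R dvec \<in> {y \<in> roots. y $ i = 0}"
      using root_shift_dvec[OF that, of "- (x $ i)"] by (simp add: dvec_def i)
  qed simp
  then show thesis by (rule that)
qed

text \<open>The positive roots \<open>\<alpha>\<^sub>i + k \<delta>\<close> take the values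
  \<open>v $ i + k (\<delta> \<bullet> v)\<close>, which tend to minus infinity.\<close>

lemma dvec_negative_not_bounded:
  assumes "dvec \<bullet> v < 0"
  shows "\<not> bounded_on_roots v"
proof
  assume b: "bounded_on_roots v"
  fix i :: 'a
  \<comment> \<open>Multiplying by the negative number \<open>dvec \<bullet> v\<close> turns this
    into \<open>v $ i + k * (dvec \<bullet> v) < -1\<close>.\<close>
  obtain k :: nat where k: "- (1 + v $ i) / (dvec \<bullet> v) < real k"
    using reals_Archimedean2 by blast
  have "axis i 1 + real k *\<^sub>R dvec \<in> positive_roots adj"
    using axis_positive_root[of i] root_shift_dvec[of "axis i 1" "real k"]
    unfolding positive_roots_alt by (auto simp: dvec_def)
  then have "-1 \<le> v $ i + k * (dvec \<bullet> v)"
    using b by (fastforce simp: inner_add_left inner_axis')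
  then show False
    using k assms by (simp add: field_simps)
qed

text \<open>In the decomposition \<open>x = y + t \<delta>\<close> there are finitely many
  \<open>y\<close>. Positivity of \<open>x\<close> gives \<open>t \<ge> 0\<close>, and negativity on
  \<open>v\<close> bounds \<open>t\<close> above because
  \<open>\<delta> \<bullet> v > 0\<close>.\<close>

lemma finite_negative_roots:
  assumes "dvec \<bullet> v > 0"
  shows "finite {x \<in> positive_roots adj. x \<bullet> v < 0}"
proof -
  obtain i where dec: "\<And>x. x \<in> roots \<Longrightarrow> \<exists>y\<in>{y \<in> roots. y $ i = 0}. x = y + (x $ i) *\<^sub>R dvec"
    using root_decompose by blast
  let ?F = "{y \<in> roots. y $ i = 0}"
  have F: "finite ?F" by (rule finite_roots_vanishing)
  \<comment> \<open>Inserting 0 keeps the maximum meaningful should \<open>?F\<close> be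
    empty.\<close>
  define M where "M = Max (insert 0 ((\<lambda>y. \<bar>y \<bullet> v\<bar>) ` ?F))"
  have M: "\<bar>y \<bullet> v\<bar> \<le> M" if "y \<in> ?F" for y
    unfolding M_def using F that by (intro Max_ge) auto
  have "{x \<in> positive_roots adj. x \<bullet> v < 0} \<subseteq>
      (\<lambda>(y, t). y + t *\<^sub>R dvec) ` (?F \<times> {t. t \<in> \<int> \<and> \<bar>t\<bar> \<le> M / (dvec \<bullet> v)})"
  proof
    fix x
    assume x: "x \<in> {x \<in> positive_roots adj. x \<bullet> v < 0}"
    then obtain y where y: "y \<in> ?F" and xy: "x = y + (x $ i) *\<^sub>R dvec"
      using dec[of x] by (auto simp: positive_roots_alt)
    have "y \<bullet> v + x $ i * (dvec \<bullet> v) < 0"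
      using x xy by (metis (mono_tags, lifting) inner_add_left inner_scaleR_left mem_Collect_eq)
    then have "x $ i * (dvec \<bullet> v) \<le> M"
      using M[OF y] by linarith
    then have "x $ i \<le> M / (dvec \<bullet> v)"
      using assms by (simp add: field_simps)
    moreover have "x $ i \<in> \<int>" "0 \<le> x $ i"
      using x by (auto simp: positive_roots_alt roots_def)
    ultimately have "(y, x $ i) \<in> ?F \<times> {t. t \<in> \<int> \<and> \<bar>t\<bar> \<le> M / (dvec \<bullet> v)}"
      using y by simp
    then show "x \<in> (\<lambda>(y, t). y + t *\<^sub>R dvec) ` (?F \<times> {t. t \<in> \<int> \<and> \<bar>t\<bar> \<le> M / (dvec \<bullet> v)})"
      using xy by (metis (no_types, lifting) case_prod_conv image_eqI)
  qed
  then show ?thesis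
    by (rule finite_subset) (intro finite_imageI finite_cartesian_product F finite_Ints_bounded)
qed

lemma finite_root_values:
  assumes "dvec \<bullet> v = 0"
  shows "finite ((\<lambda>x. x \<bullet> v) ` roots)"
proof -
  obtain i where dec: "\<And>x. x \<in> roots \<Longrightarrow> \<exists>y\<in>{y \<in> roots. y $ i = 0}. x = y + (x $ i) *\<^sub>R dvec"
    using root_decompose by blast
  have "(\<lambda>x. x \<bullet> v) ` roots \<subseteq> (\<lambda>x. x \<bullet> v) ` {y \<in> roots. y $ i = 0}"
  proof clarify
    fix x
    assume "x \<in> roots"
    then obtain y where "y \<in> {y \<in> roots. y $ i = 0}" "x = y + (x $ i) *\<^sub>R dvec"
      using dec by blast
    moreover from this have "x \<bullet> v = y \<bullet> v"
      using assms by (metis add.right_neutral inner_add_left inner_scaleR_left mult_zero_right)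
    ultimately show "x \<bullet> v \<in> (\<lambda>x. x \<bullet> v) ` {y \<in> roots. y $ i = 0}" by blast
  qed
  then show ?thesis
    by (rule finite_subset) (intro finite_imageI finite_roots_vanishing)
qed

text \<open>All coordinates of \<delta> are positive. This excludes a nonnegative end of the game
  when \<open>\<delta> \<bullet> v = 0\<close>.\<close>

lemma nonneg_dvec_zero:
  assumes "nonneg v" "dvec \<bullet> v = 0"
  shows "v = 0"
proof -
  have "dvec $ i * v $ i = 0" for i
    using assms unfolding inner_vec_def nonneg_def
    by (subst (asm) sum_nonneg_eq_0_iff) (auto simp: dvec_def)
  moreover have "dvec $ i \<noteq> 0" for i
    using d_pos[of i] by (simp add: dvec_def)
  ultimately show ?thesis
    by (simp add: vec_eq_iff)
qed

text \<open>A fired amplitude stays nonzero, \<delta> is fixed by every reflection, and the values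
  on roots are at most permuted. Roots of both signs are taken because the fired simple root changes
  sign.\<close>

lemma play_invariants:
  assumes "play adj v p" "v \<noteq> 0"
  shows "p k \<noteq> 0 \<and> dvec \<bullet> p k = dvec \<bullet> v \<and>
    (\<lambda>x. x \<bullet> p k) ` roots \<subseteq> (\<lambda>x. x \<bullet> v) ` roots"
proof (induction k)
  case 0
  then show ?case using assms by (simp add: play_def)
next
  case (Suc k)
  show ?case
  proof (cases "game_over (p k)")
    case True
    then show ?thesis using assms Suc by (simp add: play_def)
  next
    case False
    then obtain i where i: "p k $ i < 0" and p: "p (Suc k) = fire adj i (p k)"
      using assms unfolding play_def by meson
    have "fire adj i (p k) $ i \<noteq> 0"
      using i by (simp add: fire_def)
    then have "p (Suc k) \<noteq> 0"
      unfolding p by auto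
    moreover have "dvec \<bullet> p (Suc k) = dvec \<bullet> v"
      using Suc by (simp add: p inner_fire reflect_dvec)
    moreover have "(\<lambda>x. x \<bullet> p (Suc k)) ` roots \<subseteq> (\<lambda>x. x \<bullet> p k) ` roots"
      by (auto simp: p inner_fire reflect_root)
    ultimately show ?thesis
      using Suc by blast
  qed
qed

lemma bounded_on_roots_cannot_terminate:
  assumes "v \<noteq> 0" "bounded_on_roots v" "dvec \<bullet> v = 0"
  shows "cannot_terminate adj v"
  unfolding cannot_terminate_def
proof (intro allI impI)
  fix p k
  assume p: "play adj v p"
  have "\<not> forbidden (p k)"
    using play_bounded_on_roots[OF p] assms by (intro bounded_on_roots_not_forbidden) simp
  moreover have "\<not> nonneg (p k)"
    using play_invariants[OF p, of k] assms nonneg_dvec_zero by metis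
  ultimately show "\<not> game_over (p k)"
    by (simp add: game_over_def)
qed

text \<open>Amplitudes are values of simple roots, so in all plays together they stay in one finite
  set determined by \<open>v\<close>.\<close>

lemma bounded_on_roots_looping:
  assumes "v \<noteq> 0" "bounded_on_roots v" "dvec \<bullet> v = 0"
  shows "looping adj v"
proof -
  have "{p k | p k. play adj v p} \<subseteq> {w. \<forall>i. w $ i \<in> (\<lambda>x. x \<bullet> v) ` roots}"
  proof clarify
    fix p k i
    assume "play adj v p"
    then have "(\<lambda>x. x \<bullet> p k) ` roots \<subseteq> (\<lambda>x. x \<bullet> v) ` roots"
      using play_invariants assms by blast
    moreover have "axis i 1 \<in> roots" "p k $ i = axis i 1 \<bullet> p k"
      using axis_positive_root by (auto simp: positive_roots_alt inner_axis')
    ultimately show "p k $ i \<in> (\<lambda>x. x \<bullet> v) ` roots" by auto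
  qed
  then have "finite {p k | p k. play adj v p}"
    by (rule finite_subset) (intro finite_vec_entries finite_root_values assms)
  then show ?thesis
    using bounded_on_roots_cannot_terminate[OF assms] by (simp add: looping_def)
qed

lemma winning_iff:
  assumes "v \<noteq> 0"
  shows "winning adj v \<longleftrightarrow> bounded_on_roots v \<and> dvec \<bullet> v \<noteq> 0"
proof
  assume w: "winning adj v"
  have "dvec \<bullet> v \<noteq> 0"
    using bounded_on_roots_cannot_terminate[OF assms winning_bounded_on_roots[OF w]] w
    unfolding winning_def cannot_terminate_def game_over_def by blast
  then show "bounded_on_roots v \<and> dvec \<bullet> v \<noteq> 0"
    using winning_bounded_on_roots[OF w] by blast
next
  assume b: "bounded_on_roots v \<and> dvec \<bullet> v \<noteq> 0"
  \<comment> \<open>A negative value would violate (\<ast>), so a nonzero one is positive.\<close>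
  then have "dvec \<bullet> v > 0"
    using dvec_negative_not_bounded by force
  then show "winning adj v"
    using b finite_negative_roots_winning finite_negative_roots by blast
qed

end

section \<open>The diagrams\<close>

text \<open>Model edges are listed in one direction, so both are tested. Summing over all
  \<open>l < m\<close> with a conditional lets concrete diagrams be evaluated by unfolding.\<close>

definition nbr_sum :: "nat \<Rightarrow> (nat \<times> nat) set \<Rightarrow> (nat \<Rightarrow> nat) \<Rightarrow> nat \<Rightarrow> nat" where
  "nbr_sum m R D k = (\<Sum>l<m. if (k, l) \<in> R \<or> (l, k) \<in> R then D l else 0)"

lemma nbr_sum_eq:
  assumes "\<And>l. l \<in> A \<longleftrightarrow> l < m \<and> ((k, l) \<in> R \<or> (l, k) \<in> R)"
  shows "nbr_sum m R D k = sum D A"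
proof -
  have "nbr_sum m R D k = (\<Sum>l | l < m \<and> ((k, l) \<in> R \<or> (l, k) \<in> R). D l)"
    unfolding nbr_sum_def by (simp add: sum.If_cases Int_def lessThan_def)
  also have "{l. l < m \<and> ((k, l) \<in> R \<or> (l, k) \<in> R)} = A"
    using assms by blast
  finally show ?thesis .
qed

lemma nbr_sum_le:
  assumes "\<And>l. l < m \<Longrightarrow> (k, l) \<in> R \<or> (l, k) \<in> R \<Longrightarrow> l \<in> A" "finite A"
  shows "nbr_sum m R D k \<le> sum D A"
proof -
  have "nbr_sum m R D k = sum D {l. l < m \<and> ((k, l) \<in> R \<or> (l, k) \<in> R)}"
    by (rule nbr_sum_eq) simp
  also have "\<dots> \<le> sum D A"
    using assms by (intro sum_mono2) auto
  finally show ?thesis .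
qed

lemma mem_path_edges: "(k, l) \<in> path_edges m \<longleftrightarrow> l = Suc k \<and> l < m"
  by (auto simp: path_edges_def)

text \<open>The assumption \<open>parent\<close> is an easily checked form of connectedness: each
  vertex other than 0 has an earlier neighbour, so by induction a function constant along edges
  equals its value at 0.\<close>

lemma graph_iso_to_weights:
  fixes adj :: "'n::finite \<Rightarrow> 'n \<Rightarrow> bool"
  assumes "graph_iso_to adj m R"
    and irrefl: "\<And>k. k < m \<Longrightarrow> (k, k) \<notin> R"
    and parent: "\<And>k. 0 < k \<Longrightarrow> k < m \<Longrightarrow> \<exists>l<k. (k, l) \<in> R \<or> (l, k) \<in> R"
    and pos: "\<And>k. k < m \<Longrightarrow> 0 < D k"
    and super: "\<And>k. k < m \<Longrightarrow> nbr_sum m R D k \<le> 2 * D k"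
  obtains \<phi> where "bij_betw \<phi> UNIV {..<m}" "weighted_graph adj (\<lambda>i. D (\<phi> i))"
    "\<And>i. (\<Sum>j | adj i j. D (\<phi> j)) = nbr_sum m R D (\<phi> i)"
proof -
  obtain \<phi> where bij: "bij_betw \<phi> UNIV {..<m}"
    and adj: "\<And>i j. adj i j \<longleftrightarrow> (\<phi> i, \<phi> j) \<in> R \<or> (\<phi> j, \<phi> i) \<in> R"
    using assms(1) unfolding graph_iso_to_def by auto
  have lt: "\<phi> i < m" for i
    using bij by (auto simp: bij_betw_def)
  have sum: "(\<Sum>j | adj i j. D (\<phi> j)) = nbr_sum m R D (\<phi> i)" for i
  proof -
    have "nbr_sum m R D (\<phi> i) = (\<Sum>j\<in>UNIV. if adj i j then D (\<phi> j) else 0)"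
      unfolding nbr_sum_def adj by (rule sum.reindex_bij_betw[OF bij, symmetric])
    then show ?thesis by (simp add: sum.If_cases)
  qed
  have "weighted_graph adj (\<lambda>i. D (\<phi> i))"
  proof
    show "adj i j \<Longrightarrow> adj j i" for i j
      using adj by blast
    show "\<not> adj i i" for i
      using adj irrefl lt by blast
    show "0 < D (\<phi> i)" for i
      using pos lt by blast
    show "(\<Sum>j | adj i j. D (\<phi> j)) \<le> 2 * D (\<phi> i)" for i
      using super lt sum by simp
    fix f :: "'n \<Rightarrow> real"
    assume f: "\<And>i j. adj i j \<Longrightarrow> f i = f j"
    define g where "g k = f (inv \<phi> k)" for k
    have g: "g (\<phi> i) = f i" for i
      using bij by (simp add: g_def bij_betw_def)
    have "g k = g 0" if "k < m" for k
      using that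
    proof (induction k rule: less_induct)
      case (less k)
      show ?case
      proof (cases "k = 0")
        case False
        then obtain l where l: "l < k" "(k, l) \<in> R \<or> (l, k) \<in> R"
          using parent less.prems by blast
        then have "l < m" using less.prems by simp
        obtain i j where ij: "k = \<phi> i" "l = \<phi> j"
          using bij \<open>k < m\<close> \<open>l < m\<close> unfolding bij_betw_def by (metis imageE lessThan_iff)
        then have "f i = f j"
          using l f adj by blast
        then have "g k = g l"
          by (simp add: g ij)
        then show ?thesis
          using less.IH[OF l(1) \<open>l < m\<close>] by simp
      qed simp
    qed
    then show "\<exists>c. \<forall>i. f i = c"
      using g lt by metis
  qed
  with bij sum show thesis
    using that by blast
qed

lemma finite_type_graph_of_model:
  fixes adj :: "'n::finite \<Rightarrow> 'n \<Rightarrow> bool"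
  assumes "graph_iso_to adj m R"
    and "\<And>k. k < m \<Longrightarrow> (k, k) \<notin> R"
    and "\<And>k. 0 < k \<Longrightarrow> k < m \<Longrightarrow> \<exists>l<k. (k, l) \<in> R \<or> (l, k) \<in> R"
    and "\<And>k. k < m \<Longrightarrow> 0 < D k"
    and "\<And>k. k < m \<Longrightarrow> nbr_sum m R D k \<le> 2 * D k"
    and strict: "l < m" "nbr_sum m R D l < 2 * D l"
  shows "\<exists>d. finite_type_graph adj d"
proof -
  obtain \<phi> where \<phi>: "bij_betw \<phi> UNIV {..<m}" "weighted_graph adj (\<lambda>i. D (\<phi> i))"
    "\<And>i. (\<Sum>j | adj i j. D (\<phi> j)) = nbr_sum m R D (\<phi> i)"
    using graph_iso_to_weights[OF assms(1-5)] by blast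
  obtain i where "\<phi> i = l"
    using \<phi>(1) strict(1) unfolding bij_betw_def by (metis imageE lessThan_iff)
  then have "(\<Sum>j | adj i j. D (\<phi> j)) < 2 * D (\<phi> i)"
    using strict(2) by (simp add: \<phi>(3))
  then have "finite_type_graph adj (\<lambda>i. D (\<phi> i))"
    using \<phi>(2) by (auto simp: finite_type_graph_def finite_type_graph_axioms_def)
  then show ?thesis by blast
qed

lemma affine_type_graph_of_model:
  fixes adj :: "'n::finite \<Rightarrow> 'n \<Rightarrow> bool"
  assumes "graph_iso_to adj m R"
    and "\<And>k. k < m \<Longrightarrow> (k, k) \<notin> R"
    and "\<And>k. 0 < k \<Longrightarrow> k < m \<Longrightarrow> \<exists>l<k. (k, l) \<in> R \<or> (l, k) \<in> R"
    and "\<And>k. k < m \<Longrightarrow> 0 < D k"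
    and eq: "\<And>k. k < m \<Longrightarrow> nbr_sum m R D k = 2 * D k"
    and one: "l < m" "D l = 1"
  shows "\<exists>d. affine_type_graph adj d"
proof -
  obtain \<phi> where \<phi>: "bij_betw \<phi> UNIV {..<m}" "weighted_graph adj (\<lambda>i. D (\<phi> i))"
    "\<And>i. (\<Sum>j | adj i j. D (\<phi> j)) = nbr_sum m R D (\<phi> i)"
    using graph_iso_to_weights[OF assms(1-4) eq_imp_le[OF eq]] by blast
  have "\<phi> i < m" for i
    using \<phi>(1) by (auto simp: bij_betw_def)
  then have "(\<Sum>j | adj i j. D (\<phi> j)) = 2 * D (\<phi> i)" for i
    by (simp add: \<phi>(3) eq)
  moreover obtain i where "\<phi> i = l"
    using \<phi>(1) one(1) unfolding bij_betw_def by (metis imageE lessThan_iff)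
  ultimately have "affine_type_graph adj (\<lambda>i. D (\<phi> i))"
    using \<phi>(2) one(2) by (auto simp: affine_type_graph_def affine_type_graph_axioms_def)
  then show ?thesis by blast
qed

section \<open>Weights on the Dynkin diagrams\<close>

lemma path_parent: "0 < k \<Longrightarrow> k < m \<Longrightarrow> \<exists>l<k. (l, k) \<in> path_edges m"
  by (rule exI[of _ "k - 1"]) (auto simp: mem_path_edges)

lemma dynkin_A:
  assumes "graph_iso_to adj n (path_edges n)" "n \<ge> 1"
  shows "\<exists>d. finite_type_graph adj d"
proof (rule finite_type_graph_of_model[OF assms(1), where D = "\<lambda>_. 1" and l = 0])
  show "nbr_sum n (path_edges n) (\<lambda>_. 1) k \<le> 2 * 1" for k
  proof -
    \<comment> \<open>Only an upper bound: at the ends of the path the set contains a non-neighbour,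
      for instance \<open>k - 1 = 0\<close> when \<open>k = 0\<close>.\<close>
    have "nbr_sum n (path_edges n) (\<lambda>_. 1) k \<le> card {k - 1, Suc k}"
      unfolding card_eq_sum by (rule nbr_sum_le) (auto simp: mem_path_edges)
    then show ?thesis
      using card_insert_le_m1[of 2 "{Suc k}" "k - 1"] by simp
  qed
  have "nbr_sum n (path_edges n) (\<lambda>_. 1) 0 \<le> card {1 :: nat}"
    unfolding card_eq_sum by (rule nbr_sum_le) (auto simp: mem_path_edges)
  then show "nbr_sum n (path_edges n) (\<lambda>_. 1) 0 < 2 * 1" by simp
qed (use assms(2) path_parent in \<open>auto simp: mem_path_edges\<close>)

text \<open>Weight 2 from the far end 0 up to the branch vertex \<open>t + 1\<close>, weight 1 on
  the leaves \<open>t + 2\<close> and \<open>t + 3\<close>. At 0 the inequality is strict: the only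
  neighbour has weight 2, against the bound 4.\<close>

lemma dynkin_D:
  assumes "graph_iso_to adj n (path_edges (n - 1) \<union> {(n - 3, n - 1)})" "n \<ge> 4"
  shows "\<exists>d. finite_type_graph adj d"
proof -
  \<comment> \<open>This replaces truncated subtractions by sums.\<close>
  define t where "t = n - 4"
  have eqs: "n - 1 = t + 3" "n - 3 = t + 1" "n + 1 = t + 5" "n = t + 4"
    using assms(2) by (auto simp: t_def)
  let ?R = "path_edges (t + 3) \<union> {(t + 1, t + 3)}" and ?D = "\<lambda>k. if k \<le> t + 1 then 2 else 1"
  have iso: "graph_iso_to adj (t + 4) ?R"
    using assms(1)[unfolded eqs(1-3)] by (simp only: eqs(4))
  have first: "nbr_sum (t + 4) ?R ?D 0 \<le> sum ?D {1}"
    by (rule nbr_sum_le) (auto simp: mem_path_edges)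
  show ?thesis
  proof (rule finite_type_graph_of_model[OF iso, where D = ?D and l = 0])
    fix k
    assume "0 < k" "k < t + 4"
    then show "\<exists>l<k. (k, l) \<in> ?R \<or> (l, k) \<in> ?R"
      using path_parent[of k "t + 3"] by (cases "k = t + 3") (auto intro: exI[of _ "t + 1"])
  next
    fix k
    assume "k < t + 4"
    then consider "k = 0" | "0 < k" "k \<le> t" | "k = t + 1" | "k = t + 2 \<or> k = t + 3"
      by linarith
    then show "nbr_sum (t + 4) ?R ?D k \<le> 2 * ?D k"
    proof cases
      case 1
      then show ?thesis using first by simp
    next
      case 2
      then have "nbr_sum (t + 4) ?R ?D k \<le> sum ?D {k - 1, k + 1}"
        by (intro nbr_sum_le) (auto simp: mem_path_edges)
      moreover have "k - 1 \<le> t + 1"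
        using 2 by simp
      ultimately show ?thesis using 2 by simp
    next
      case 3
      then have "nbr_sum (t + 4) ?R ?D k \<le> sum ?D {t, t + 2, t + 3}"
        by (intro nbr_sum_le) (auto simp: mem_path_edges)
      then show ?thesis using 3 by simp
    next
      case 4
      then have "nbr_sum (t + 4) ?R ?D k \<le> sum ?D {t + 1}"
        by (intro nbr_sum_le) (auto simp: mem_path_edges)
      then show ?thesis using 4 by auto
    qed
  next
    show "nbr_sum (t + 4) ?R ?D 0 < 2 * ?D 0"
      using first by simp
  qed (auto simp: mem_path_edges)
qed

text \<open>The weights are the marks of the extended diagram \<open>E\<^sub>8\<close>, restricted to the subdiagram \<open>E\<^sub>n\<close>.\<close>

lemma dynkin_E:
  assumes "graph_iso_to adj n (path_edges (n - 1) \<union> {(2, n - 1)})" "n \<in> {6, 7, 8}"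
  shows "\<exists>d. finite_type_graph adj d"
proof -
  let ?R = "path_edges (n - 1) \<union> {(2, n - 1)}"
  let ?D = "\<lambda>k. if k = n - 1 then 3 else if k < 2 then 2 * k + 2 else 8 - k"
  \<comment> \<open>Strictness occurs at the end \<open>n - 2\<close> of the truncated arm, which
    has lost a neighbour of the extended diagram.\<close>
  have le: "\<forall>k<n. nbr_sum n ?R ?D k \<le> 2 * ?D k" and less: "nbr_sum n ?R ?D (n - 2) < 2 * ?D (n - 2)"
    using assms(2) by (auto simp: nbr_sum_def mem_path_edges numeral_eq_Suc All_less_Suc)
  show ?thesis
  proof (rule finite_type_graph_of_model[OF assms(1), where D = ?D and l = "n - 2"])
    fix k
    assume "0 < k" "k < n"
    then show "\<exists>l<k. (k, l) \<in> ?R \<or> (l, k) \<in> ?R"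
      using path_parent[of k "n - 1"] assms(2)
      by (cases "k = n - 1") (auto intro: exI[of _ 2])
  next
    show "nbr_sum n ?R ?D k \<le> 2 * ?D k" if "k < n" for k
      using le that by blast
  qed (use assms(2) less in \<open>auto simp: mem_path_edges\<close>)
qed

lemma dynkin_graph_finite_type:
  "dynkin_graph adj \<Longrightarrow> \<exists>d. finite_type_graph adj d"
  unfolding dynkin_graph_def using dynkin_A dynkin_D dynkin_E by metis

section \<open>Marks of the extended Dynkin diagrams\<close>

lemma extended_A:
  assumes "graph_iso_to adj (n + 1) (path_edges (n + 1) \<union> {(n, 0)})" "n \<ge> 2"
  shows "\<exists>d. affine_type_graph adj d"
proof (rule affine_type_graph_of_model[OF assms(1), where D = "\<lambda>_. 1" and l = 0])
  let ?R = "path_edges (n + 1) \<union> {(n, 0)}"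
  fix k
  assume "k < n + 1"
  then consider "k = 0" | "0 < k" "k < n" | "k = n"
    by linarith
  then show "nbr_sum (n + 1) ?R (\<lambda>_. 1) k = 2 * 1"
  proof cases
    case 1
    \<comment> \<open>For \<open>n \<ge> 2\<close> the two neighbours 1 and \<open>n\<close> of
      vertex 0 are distinct.\<close>
    then have "nbr_sum (n + 1) ?R (\<lambda>_. 1) k = sum (\<lambda>_. 1) {1, n}"
      using assms(2) by (intro nbr_sum_eq) (auto simp: mem_path_edges)
    then show ?thesis using assms(2) by simp
  next
    case 2
    then have "nbr_sum (n + 1) ?R (\<lambda>_. 1) k = sum (\<lambda>_. 1) {k - 1, k + 1}"
      by (intro nbr_sum_eq) (auto simp: mem_path_edges)
    then show ?thesis by simp
  next
    case 3
    then have "nbr_sum (n + 1) ?R (\<lambda>_. 1) k = sum (\<lambda>_. 1) {0, n - 1}"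
      using assms(2) by (intro nbr_sum_eq) (auto simp: mem_path_edges)
    then show ?thesis using assms(2) by simp
  qed
qed (use assms(2) path_parent[of _ "n + 1"] in \<open>auto simp: mem_path_edges\<close>)

text \<open>The inner vertices 1 to \<open>t + 1\<close> have mark 2, the four leaves mark 1. For
  \<open>t = 0\<close> the two branch vertices coincide, which needs a case of its own.\<close>

lemma extended_D:
  assumes "graph_iso_to adj (n + 1) (path_edges (n - 1) \<union> {(1, n - 1), (n - 3, n)})" "n \<ge> 4"
  shows "\<exists>d. affine_type_graph adj d"
proof -
  define t where "t = n - 4"
  have eqs: "n - 1 = t + 3" "n - 3 = t + 1" "n + 1 = t + 5" "n = t + 4"
    using assms(2) by (auto simp: t_def)
  let ?R = "path_edges (t + 3) \<union> {(1, t + 3), (t + 1, t + 4)}"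
  let ?D = "\<lambda>k. if 1 \<le> k \<and> k \<le> t + 1 then 2 else 1"
  have iso: "graph_iso_to adj (t + 5) ?R"
    using assms(1)[unfolded eqs(1-3)] by (simp only: eqs(4))
  show ?thesis
  proof (rule affine_type_graph_of_model[OF iso, where D = ?D and l = 0])
    fix k
    assume "0 < k" "k < t + 5"
    then show "\<exists>l<k. (k, l) \<in> ?R \<or> (l, k) \<in> ?R"
      using path_parent[of k "t + 3"] 
      by (cases "k < t + 3"; cases "k = t + 3") (auto intro: exI[of _ 1] exI[of _ "t + 1"])
  next
    fix k
    assume "k < t + 5"
    then consider "k = 0" | "k = 1" "t = 0" | "k = 1" "t > 0" | "2 \<le> k" "k \<le> t"
      | "k = t + 1" "t > 0" | "k = t + 2 \<or> k = t + 4" | "k = t + 3"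
      by linarith
    then show "nbr_sum (t + 5) ?R ?D k = 2 * ?D k"
    proof cases
      case 1
      then have "nbr_sum (t + 5) ?R ?D k = sum ?D {1}"
        by (intro nbr_sum_eq) (auto simp: mem_path_edges)
      then show ?thesis using 1 by simp
    next
      case 2
      then have "nbr_sum (t + 5) ?R ?D k = sum ?D {0, 2, 3, 4}"
        by (intro nbr_sum_eq) (auto simp: mem_path_edges)
      then show ?thesis using 2 by simp
    next
      case 3
      then have "nbr_sum (t + 5) ?R ?D k = sum ?D {0, 2, t + 3}"
        by (intro nbr_sum_eq) (auto simp: mem_path_edges)
      then show ?thesis using 3 by simp
    next
      case 4
      then have "nbr_sum (t + 5) ?R ?D k = sum ?D {k - 1, k + 1}"
        by (intro nbr_sum_eq) (auto simp: mem_path_edges)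
      moreover have "1 \<le> k - 1" "k - 1 \<le> t + 1"
        using 4 by auto
      ultimately show ?thesis using 4 by simp
    next
      case 5
      then have "nbr_sum (t + 5) ?R ?D k = sum ?D {t, t + 2, t + 4}"
        by (intro nbr_sum_eq) (auto simp: mem_path_edges)
      then show ?thesis using 5 by simp
    next
      case 6
      then have "nbr_sum (t + 5) ?R ?D k = sum ?D {t + 1}"
        by (intro nbr_sum_eq) (auto simp: mem_path_edges)
      then show ?thesis using 6 by auto
    next
      case 7
      then have "nbr_sum (t + 5) ?R ?D k = sum ?D {1}"
        by (intro nbr_sum_eq) (auto simp: mem_path_edges)
      then show ?thesis using 7 by simp
    qed
  qed (auto simp: mem_path_edges)
qed

text \<open>The marks are listed along the path first and then outwards along the remaining arm; all
  conditions are checked by evaluation.\<close>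

lemma extended_E6:
  assumes "graph_iso_to adj 7 (path_edges 5 \<union> {(2, 5), (5, 6)})"
  shows "\<exists>d. affine_type_graph adj d"
proof -
  let ?R = "path_edges 5 \<union> {(2, 5), (5, 6)}" and ?D = "\<lambda>k. [1, 2, 3, 2, 1, 2, 1] ! k :: nat"
  have "\<forall>k<7. 0 < ?D k" "\<forall>k<7. nbr_sum 7 ?R ?D k = 2 * ?D k"
    "\<forall>k<7. 0 < k \<longrightarrow> (\<exists>l<k. (k, l) \<in> ?R \<or> (l, k) \<in> ?R)"
    by (auto simp: nbr_sum_def mem_path_edges numeral_eq_Suc All_less_Suc Ex_less_Suc)
  then show ?thesis
    by (intro affine_type_graph_of_model[OF assms, where D = ?D and l = 0])
      (auto simp: mem_path_edges)
qed

lemma extended_E7: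
  assumes "graph_iso_to adj 8 (path_edges 7 \<union> {(3, 7)})"
  shows "\<exists>d. affine_type_graph adj d"
proof -
  let ?R = "path_edges 7 \<union> {(3, 7)}" and ?D = "\<lambda>k. [1, 2, 3, 4, 3, 2, 1, 2] ! k :: nat"
  have "\<forall>k<8. 0 < ?D k" "\<forall>k<8. nbr_sum 8 ?R ?D k = 2 * ?D k"
    "\<forall>k<8. 0 < k \<longrightarrow> (\<exists>l<k. (k, l) \<in> ?R \<or> (l, k) \<in> ?R)"
    by (auto simp: nbr_sum_def mem_path_edges numeral_eq_Suc All_less_Suc Ex_less_Suc)
  then show ?thesis
    by (intro affine_type_graph_of_model[OF assms, where D = ?D and l = 0])
      (auto simp: mem_path_edges)
qed

lemma extended_E8:
  assumes "graph_iso_to adj 9 (path_edges 8 \<union> {(2, 8)})"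
  shows "\<exists>d. affine_type_graph adj d"
proof -
  let ?R = "path_edges 8 \<union> {(2, 8)}" and ?D = "\<lambda>k. [2, 4, 6, 5, 4, 3, 2, 1, 3] ! k :: nat"
  have "\<forall>k<9. 0 < ?D k" "\<forall>k<9. nbr_sum 9 ?R ?D k = 2 * ?D k"
    "\<forall>k<9. 0 < k \<longrightarrow> (\<exists>l<k. (k, l) \<in> ?R \<or> (l, k) \<in> ?R)"
    by (auto simp: nbr_sum_def mem_path_edges numeral_eq_Suc All_less_Suc Ex_less_Suc)
  then show ?thesis
    \<comment> \<open>Here the only mark 1 is at vertex 7, the end of the longest arm.\<close>
    by (intro affine_type_graph_of_model[OF assms, where D = ?D and l = 7])
      (auto simp: mem_path_edges)
qed

lemma extended_dynkin_graph_affine_type: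
  "extended_dynkin_graph adj \<Longrightarrow> \<exists>d. affine_type_graph adj d"
  unfolding extended_dynkin_graph_def
  using extended_A extended_D extended_E6 extended_E7 extended_E8 by metis

theorem theorem3p1:
  fixes adj :: "'n::finite \<Rightarrow> 'n \<Rightarrow> bool" and v :: "real^'n"
  shows
    "(dynkin_graph adj \<longrightarrow>
        (winning adj v \<longleftrightarrow> (\<forall>\<alpha>\<in>positive_roots adj. \<alpha> \<bullet> v \<ge> -1)) \<and>
        (\<not> (\<forall>\<alpha>\<in>positive_roots adj. \<alpha> \<bullet> v \<ge> -1) \<longrightarrow> losing adj v)) \<and>
     (extended_dynkin_graph adj \<and> v \<noteq> 0 \<longrightarrow>
        (winning adj v \<longleftrightarrow>
           (\<forall>\<alpha>\<in>positive_roots adj. \<alpha> \<bullet> v \<ge> -1) \<and> delta adj \<bullet> v \<noteq> 0) \<and>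
        ((\<forall>\<alpha>\<in>positive_roots adj. \<alpha> \<bullet> v \<ge> -1) \<and> delta adj \<bullet> v = 0 \<longrightarrow>
           looping adj v \<and> cannot_terminate adj v) \<and>
        (\<not> (\<forall>\<alpha>\<in>positive_roots adj. \<alpha> \<bullet> v \<ge> -1) \<longrightarrow> losing adj v) \<and>
        (delta adj \<bullet> v < 0 \<longrightarrow> \<not> (\<forall>\<alpha>\<in>positive_roots adj. \<alpha> \<bullet> v \<ge> -1)))"
proof (intro conjI[of "_ \<longrightarrow> _"] impI)
  assume "dynkin_graph adj"
  then obtain d where "finite_type_graph adj d"
    using dynkin_graph_finite_type by blast
  then interpret finite_type_graph adj d .
  show "(winning adj v \<longleftrightarrow> bounded_on_roots v) \<and> (\<not> bounded_on_roots v \<longrightarrow> losing adj v)"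
    using winning_iff not_bounded_on_roots_losing by blast
next
  assume ext: "extended_dynkin_graph adj \<and> v \<noteq> 0"
  then obtain d where "affine_type_graph adj d"
    using extended_dynkin_graph_affine_type by blast
  then interpret affine_type_graph adj d .
  show "(winning adj v \<longleftrightarrow> bounded_on_roots v \<and> delta adj \<bullet> v \<noteq> 0) \<and>
    (bounded_on_roots v \<and> delta adj \<bullet> v = 0 \<longrightarrow> looping adj v \<and> cannot_terminate adj v) \<and>
    (\<not> bounded_on_roots v \<longrightarrow> losing adj v) \<and>
    (delta adj \<bullet> v < 0 \<longrightarrow> \<not> bounded_on_roots v)"
    \<comment> \<open>The definite description of \<delta> becomes the explicit weight
      vector.\<close>
    unfolding delta_eq
    using ext winning_iff bounded_on_roots_looping bounded_on_roots_cannot_terminate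
      not_bounded_on_roots_losing dvec_negative_not_bounded by blast
qed

end
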